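(* Let $k\ge1$ be an integer, $L>0$, and suppose $f:[0,1]\to\mathbb{R}$ satisfies condition $D_{2k}$ with parameter $L$. Let $n\hat p_n\sim\mathrm{Binomial}(n,p)$, and let $\hat f_k=\sum_{i=0}^{k-1}\frac1{n^i}t_i(\hat p_n)$ be the Taylor series bias corrected estimator, where $t_0=f$ and $t_i=-\sum_{j=1}^iT_j[t_{i-j}]$ for $i\ge1$. Then $$\sup_{p\in[0,1]}\big|\mathbb{E}_p[\hat f_k]-f(p)\big|\lesssim_{k,L}\frac1{n^k},$$ i.e. the left side is at most $M n^{-k}$ for all $n\ge1$, with $M$ depending only on $k$ and $L$.
   Context: Condition $D_s$ ($s\ge1$) with parameter $L$: $f^{(s-1)}$ is absolutely continuous on $[0,1]$ and $\sup_{x\in[0,1]}|f^{(i)}(x)|\le L$ for $0\le i\le s$. The operators $T_j$: for each integer $i\ge1$ there are polynomials $h_{m,i}(p)$, $1\le m\le\lfloor i/2\rfloor$, with coefficients independent of $n$, such that $\mathbb{E}_p(\hat p_n-p)^i=\sum_{m=1}^{\lfloor i/2\rfloor}h_{m,i}(p)\,n^{-(i-m)}$ for all $n$. For $j\ge1$, $T_j$ is the linear differential operator, independent of $n$, $$T_j[g](p)=\sum_{i=j+1}^{2j}\frac{g^{(i)}(p)}{i!}h_{i-j,i}(p),$$ so that $T_j[g]$ is the coefficient of $n^{-j}$ in the formal Taylor expansion of $\mathbb{E}_pg(\hat p_n)-g(p)$. *)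

theory Defs
  imports "HOL-Probability.Probability"
begin

(* One-sided at the endpoints; depends only on the values of f on [0,1]. *)
definition deriv01 :: "(real \<Rightarrow> real) \<Rightarrow> real \<Rightarrow> real" where
  "deriv01 f x = vector_derivative f (at x within {0..1})"

abbreviation nderiv01 :: "nat \<Rightarrow> (real \<Rightarrow> real) \<Rightarrow> real \<Rightarrow> real" where
  "nderiv01 i \<equiv> deriv01 ^^ i"

definition absolutely_continuous_on :: "real set \<Rightarrow> (real \<Rightarrow> real) \<Rightarrow> bool" where
  "absolutely_continuous_on S g \<longleftrightarrow>
     (\<forall>\<epsilon>>0. \<exists>\<delta>>0. \<forall>(N::nat) a b.
        (\<forall>i<N. a i \<le> b i \<and> {a i..b i} \<subseteq> S) \<longrightarrow>
        disjoint_family_on (\<lambda>i. {a i<..<b i}) {..<N} \<longrightarrow>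
        (\<Sum>i<N. b i - a i) < \<delta> \<longrightarrow>
        (\<Sum>i<N. \<bar>g (b i) - g (a i)\<bar>) < \<epsilon>)"

(* Absolute continuity of the (s-1)st derivative gives the s-th derivative only almost
   everywhere, so the bound on the top derivative is an almost-everywhere bound. *)
definition condition_D :: "nat \<Rightarrow> real \<Rightarrow> (real \<Rightarrow> real) \<Rightarrow> bool" where
  "condition_D s L f \<longleftrightarrow>
     (\<forall>i<s - 1. nderiv01 i f differentiable_on {0..1}) \<and>
     absolutely_continuous_on {0..1} (nderiv01 (s - 1) f) \<and>
     (\<forall>i<s. \<forall>x\<in>{0..1}. \<bar>nderiv01 i f x\<bar> \<le> L) \<and>
     (AE x in lborel. x \<in> {0..1} \<longrightarrow>
        nderiv01 (s - 1) f differentiable (at x within {0..1}) \<and> \<bar>nderiv01 s f x\<bar> \<le> L)"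

definition binomial_expectation :: "nat \<Rightarrow> real \<Rightarrow> (real \<Rightarrow> real) \<Rightarrow> real" where
  "binomial_expectation n p g =
     measure_pmf.expectation (binomial_pmf n p) (\<lambda>x. g (real x / real n))"

definition is_moment_coeff :: "(nat \<Rightarrow> nat \<Rightarrow> real poly) \<Rightarrow> bool" where
  "is_moment_coeff h \<longleftrightarrow>
     (\<forall>i\<ge>1. \<forall>n\<ge>1. \<forall>p\<in>{0..1}.
        binomial_expectation n p (\<lambda>q. (q - p) ^ i) =
        (\<Sum>m=1..i div 2. poly (h m i) p / real n ^ (i - m)))"

definition moment_coeff :: "nat \<Rightarrow> nat \<Rightarrow> real poly" where
  "moment_coeff = (SOME h. is_moment_coeff h)"

definition taylor_T :: "nat \<Rightarrow> (real \<Rightarrow> real) \<Rightarrow> real \<Rightarrow> real" where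
  "taylor_T j g p = (\<Sum>i=j+1..2*j. nderiv01 i g p / fact i * poly (moment_coeff (i - j) i) p)"

fun taylor_t :: "(real \<Rightarrow> real) \<Rightarrow> nat \<Rightarrow> real \<Rightarrow> real" where
  "taylor_t f 0 = f"
| "taylor_t f (Suc i) = (\<lambda>p. - (\<Sum>j=1..Suc i. taylor_T j (taylor_t f (Suc i - j)) p))"

definition taylor_estimator :: "(real \<Rightarrow> real) \<Rightarrow> nat \<Rightarrow> nat \<Rightarrow> real \<Rightarrow> real" where
  "taylor_estimator f k n q = (\<Sum>i<k. 1 / real n ^ i * taylor_t f i q)"


(* Existence of the moment coefficients, from the recursion
   mu_(i+1) = p (1 - p) (mu_i' + n i mu_(i-1)) for mu_i = E (X - n p)^i, X ~ Binomial(n,p). *)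

fun central_moment_poly :: "nat \<Rightarrow> nat \<Rightarrow> real poly" where
  "central_moment_poly m 0 = (if m = 0 then 1 else 0)"
| "central_moment_poly m (Suc 0) = 0"
| "central_moment_poly m (Suc (Suc i)) =
     [:0, 1, -1:] * (pderiv (central_moment_poly m (Suc i)) +
       (if m = 0 then 0 else smult (real (Suc i)) (central_moment_poly (m - 1) i)))"

lemma central_moment_poly_0: "i \<ge> 1 \<Longrightarrow> central_moment_poly 0 i = 0"
  by (induction "0::nat" i rule: central_moment_poly.induct) auto

lemma central_moment_poly_eq_0: "m > i div 2 \<Longrightarrow> central_moment_poly m i = 0"
  by (induction m i rule: central_moment_poly.induct) auto

definition binomial_central_sum :: "nat \<Rightarrow> nat \<Rightarrow> real \<Rightarrow> real" where
  "binomial_central_sum n i p =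
     (\<Sum>x\<le>n. real (n choose x) * p ^ x * (1 - p) ^ (n - x) * (real x - real n * p) ^ i)"

lemma weight_deriv:
  fixes p :: real
  assumes "x \<le> n"
  shows "\<exists>D. ((\<lambda>p. p ^ x * (1 - p) ^ (n - x)) has_real_derivative D) (at p) \<and>
             p * (1 - p) * D = (real x - real n * p) * (p ^ x * (1 - p) ^ (n - x))"
proof -
  let ?D = "real x * p ^ (x - 1) * (1 - p) ^ (n - x) -
            p ^ x * (real (n - x) * (1 - p) ^ (n - x - 1))"
  have 1: "((\<lambda>p. p ^ x * (1 - p) ^ (n - x)) has_real_derivative ?D) (at p)"
    by (auto intro!: derivative_eq_intros)
  have a: "p * (real x * p ^ (x - 1)) = real x * p ^ x"
    by (cases x) auto
  have b: "(1 - p) * (real (n - x) * (1 - p) ^ (n - x - 1)) = real (n - x) * (1 - p) ^ (n - x)"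
    by (cases "n - x") auto
  have "p * (1 - p) * ?D = (1 - p) * (1 - p) ^ (n - x) * (p * (real x * p ^ (x - 1))) -
     p * p ^ x * ((1 - p) * (real (n - x) * (1 - p) ^ (n - x - 1)))"
    by (simp add: algebra_simps)
  also have "\<dots> = (real x - real n * p) * (p ^ x * (1 - p) ^ (n - x))"
    unfolding a b using assms by (simp add: of_nat_diff algebra_simps)
  finally show ?thesis using 1 by blast
qed

lemma binomial_central_sum_rec:
  assumes D: "(binomial_central_sum n (Suc i) has_real_derivative D) (at p)"
  shows "binomial_central_sum n (Suc (Suc i)) p =
           p * (1 - p) * (D + real n * real (Suc i) * binomial_central_sum n i p)"
proof -
  define w where "w x p = p ^ x * (1 - p) ^ (n - x)" for x and p :: real
  have "\<forall>x\<in>{..n}. \<exists>d. (w x has_real_derivative d) (at p) \<and>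
             p * (1 - p) * d = (real x - real n * p) * w x p"
    using weight_deriv unfolding w_def by blast
  then obtain d where d: "\<And>x. x \<le> n \<Longrightarrow> (w x has_real_derivative d x) (at p)"
      "\<And>x. x \<le> n \<Longrightarrow> p * (1 - p) * d x = (real x - real n * p) * w x p"
    by (metis atMost_iff)
  have eq: "binomial_central_sum n j q = (\<Sum>x\<le>n. real (n choose x) * (w x q * (real x - real n * q) ^ j))"
    for j q unfolding binomial_central_sum_def w_def by (simp add: mult.assoc)
  let ?E = "\<Sum>x\<le>n. real (n choose x) * (d x * (real x - real n * p) ^ Suc i -
              w x p * (real n * real (Suc i) * (real x - real n * p) ^ i))"
  have "((\<lambda>q. \<Sum>x\<le>n. real (n choose x) * (w x q * (real x - real n * q) ^ Suc i))
          has_real_derivative ?E) (at p)"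
  proof (rule DERIV_sum)
    fix x assume "x \<in> {..n}"
    then have x: "x \<le> n" by simp
    have "((\<lambda>q. (real x - real n * q) ^ Suc i) has_real_derivative
            (- real n * real (Suc i) * (real x - real n * p) ^ i)) (at p)"
      by (auto intro!: derivative_eq_intros simp del: power_Suc)
    from DERIV_cmult[OF DERIV_mult[OF d(1)[OF x] this], of "real (n choose x)"]
    show "((\<lambda>q. real (n choose x) * (w x q * (real x - real n * q) ^ Suc i)) has_real_derivative
       real (n choose x) * (d x * (real x - real n * p) ^ Suc i -
              w x p * (real n * real (Suc i) * (real x - real n * p) ^ i))) (at p)"
      by (simp add: algebra_simps)
  qed
  then have "(binomial_central_sum n (Suc i) has_real_derivative ?E) (at p)"
    unfolding eq[abs_def] .
  then have DE: "D = ?E"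
    using D DERIV_unique by blast
  have sp: "?E + real n * real (Suc i) * binomial_central_sum n i p =
        (\<Sum>x\<le>n. real (n choose x) * (d x * (real x - real n * p) ^ Suc i))"
    unfolding eq sum_distrib_left sum.distrib[symmetric]
    by (intro sum.cong refl) (simp add: algebra_simps)
  have "p * (1 - p) * (\<Sum>x\<le>n. real (n choose x) * (d x * (real x - real n * p) ^ Suc i)) =
        binomial_central_sum n (Suc (Suc i)) p"
    unfolding eq sum_distrib_left
  proof (intro sum.cong refl)
    fix x assume "x \<in> {..n}"
    then have "p * (1 - p) * d x = (real x - real n * p) * w x p" using d(2) by simp
    then have "real (n choose x) * ((p * (1 - p) * d x) * (real x - real n * p) ^ Suc i) =
       real (n choose x) * (((real x - real n * p) * w x p) * (real x - real n * p) ^ Suc i)"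
      by presburger
    then show "p * (1 - p) * (real (n choose x) * (d x * (real x - real n * p) ^ Suc i)) =
       real (n choose x) * (w x p * (real x - real n * p) ^ Suc (Suc i))"
      by (simp add: ac_simps)
  qed
  then show ?thesis unfolding DE sp by simp
qed

lemma binomial_weights_sum: "(\<Sum>x\<le>n. real (n choose x) * p ^ x * (1 - p) ^ (n - x)) = 1"
  using binomial_ring[of p "1 - p" n] by simp

lemma binomial_central_sum_1: "binomial_central_sum n (Suc 0) p = 0"
proof -
  define w where "w x p = p ^ x * (1 - p) ^ (n - x)" for x and p :: real
  have "\<forall>x\<in>{..n}. \<exists>d. (w x has_real_derivative d) (at p) \<and>
             p * (1 - p) * d = (real x - real n * p) * w x p"
    using weight_deriv unfolding w_def by blast
  then obtain d where d: "\<And>x. x \<le> n \<Longrightarrow> (w x has_real_derivative d x) (at p)"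
      "\<And>x. x \<le> n \<Longrightarrow> p * (1 - p) * d x = (real x - real n * p) * w x p"
    by (metis atMost_iff)
  have "((\<lambda>p. \<Sum>x\<le>n. real (n choose x) * w x p) has_real_derivative
      (\<Sum>x\<le>n. real (n choose x) * d x)) (at p)"
    by (intro DERIV_sum DERIV_cmult d(1)) auto
  moreover have "(\<lambda>p. \<Sum>x\<le>n. real (n choose x) * w x p) = (\<lambda>p. 1)"
    using binomial_weights_sum by (simp add: w_def mult.assoc)
  ultimately have "((\<lambda>p. 1) has_real_derivative (\<Sum>x\<le>n. real (n choose x) * d x)) (at p)"
    by simp
  then have 0: "(\<Sum>x\<le>n. real (n choose x) * d x) = 0"
    using DERIV_const DERIV_unique by blast
  have "binomial_central_sum n (Suc 0) p = (\<Sum>x\<le>n. p * (1 - p) * (real (n choose x) * d x))"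
    unfolding binomial_central_sum_def
  proof (intro sum.cong refl)
    fix x assume "x \<in> {..n}"
    then have "p * (1 - p) * d x = (real x - real n * p) * w x p" using d(2) by simp
    then have "real (n choose x) * (p * (1 - p) * d x) =
       real (n choose x) * ((real x - real n * p) * w x p)"
      by presburger
    then show "real (n choose x) * p ^ x * (1 - p) ^ (n - x) * (real x - real n * p) ^ Suc 0 =
       p * (1 - p) * (real (n choose x) * d x)"
      by (auto simp: w_def ac_simps)
  qed
  also have "\<dots> = 0" using 0 by (simp add: sum_distrib_left[symmetric])
  finally show ?thesis .
qed

lemma binomial_central_sum_poly:
  assumes "K \<ge> i"
  shows "binomial_central_sum n i p = (\<Sum>m\<le>K. poly (central_moment_poly m i) p * real n ^ m)"
  using assms
proof (induction i arbitrary: K p rule: induct_nat_012)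
  case 0
  have "(\<Sum>m\<le>K. poly (central_moment_poly m 0) p * real n ^ m) =
        (\<Sum>m\<le>K. if m = 0 then 1 else 0)"
    by (intro sum.cong) auto
  also have "\<dots> = (1::real)" by (simp add: sum.delta)
  finally show ?case
    by (simp add: binomial_central_sum_def binomial_weights_sum)
next
  case 1
  show ?case by (simp add: binomial_central_sum_1)
next
  case (ge2 i)
  then obtain K' where K: "K = Suc K'" and K': "K' \<ge> i" "K \<ge> Suc i"
    by (cases K) auto
  let ?D = "\<Sum>m\<le>K. poly (pderiv (central_moment_poly m (Suc i))) p * real n ^ m"
  have fn: "binomial_central_sum n (Suc i) =
      (\<lambda>p. \<Sum>m\<le>K. poly (central_moment_poly m (Suc i)) p * real n ^ m)"
    using ge2.IH(2)[OF K'(2)] by blast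
  have "(binomial_central_sum n (Suc i) has_real_derivative ?D) (at p)"
    unfolding fn by (intro DERIV_sum DERIV_cmult_right poly_DERIV)
  note rec = binomial_central_sum_rec[OF this]
  have "(\<Sum>m\<le>K. poly (central_moment_poly m (Suc (Suc i))) p * real n ^ m) =
     (\<Sum>m\<le>K. p * (1 - p) * (poly (pderiv (central_moment_poly m (Suc i))) p * real n ^ m +
        (if m = 0 then 0 else real (Suc i) * poly (central_moment_poly (m - 1) i) p * real n ^ m)))"
    by (intro sum.cong refl) (simp add: algebra_simps)
  also have "\<dots> = p * (1 - p) * (?D +
      (\<Sum>m\<le>K. if m = 0 then 0 else real (Suc i) * poly (central_moment_poly (m - 1) i) p * real n ^ m))"
    by (simp only: sum_distrib_left[symmetric] sum.distrib)
  also have "(\<Sum>m\<le>K. if m = 0 then 0 else real (Suc i) * poly (central_moment_poly (m - 1) i) p * real n ^ m) =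
     (\<Sum>m\<le>K'. real (Suc i) * poly (central_moment_poly m i) p * real n ^ Suc m)"
    unfolding K by (subst sum.atMost_Suc_shift) simp
  also have "\<dots> = real n * real (Suc i) * binomial_central_sum n i p"
    unfolding ge2.IH(1)[OF K'(1)] sum_distrib_left
    by (intro sum.cong refl) (simp add: algebra_simps)
  finally show ?case using rec by simp
qed

lemma binomial_expectation_central:
  assumes "n \<ge> 1" "p \<in> {0..1}"
  shows "binomial_expectation n p (\<lambda>q. (q - p) ^ i) = binomial_central_sum n i p / real n ^ i"
proof -
  have "binomial_expectation n p (\<lambda>q. (q - p) ^ i) =
      (\<Sum>x\<le>n. (real x / real n - p) ^ i * pmf (binomial_pmf n p) x)"
    unfolding binomial_expectation_def using assms
    by (intro integral_measure_pmf_real) (auto simp: set_pmf_binomial_eq split: if_splits)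
  also have "\<dots> = (\<Sum>x\<le>n. real (n choose x) * p ^ x * (1 - p) ^ (n - x) * (real x - real n * p) ^ i / real n ^ i)"
  proof (intro sum.cong refl)
    fix x
    have "real x / real n - p = (real x - real n * p) / real n"
      using assms by (simp add: field_simps)
    then show "(real x / real n - p) ^ i * pmf (binomial_pmf n p) x =
      real (n choose x) * p ^ x * (1 - p) ^ (n - x) * (real x - real n * p) ^ i / real n ^ i"
      using assms by (simp add: power_divide)
  qed
  finally show ?thesis
    by (simp add: binomial_central_sum_def sum_divide_distrib)
qed

lemma is_moment_coeff_central_moment_poly: "is_moment_coeff central_moment_poly"
  unfolding is_moment_coeff_def
proof (intro allI impI ballI)
  fix i n :: nat and p :: real
  assume i: "i \<ge> 1" and n: "n \<ge> 1" and p: "p \<in> {0..1}"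
  have "binomial_expectation n p (\<lambda>q. (q - p) ^ i) =
     (\<Sum>m\<le>i. poly (central_moment_poly m i) p * real n ^ m / real n ^ i)"
    using binomial_expectation_central[OF n p] binomial_central_sum_poly[of i i n p]
    by (simp add: sum_divide_distrib)
  also have "\<dots> = (\<Sum>m=1..i div 2. poly (central_moment_poly m i) p * real n ^ m / real n ^ i)"
  proof (intro sum.mono_neutral_right ballI)
    fix m assume "m \<in> {..i} - {1..i div 2}"
    then have "m = 0 \<or> m > i div 2" by auto
    then show "poly (central_moment_poly m i) p * real n ^ m / real n ^ i = 0"
      using i by (auto simp: central_moment_poly_0 central_moment_poly_eq_0)
  qed auto
  also have "\<dots> = (\<Sum>m=1..i div 2. poly (central_moment_poly m i) p / real n ^ (i - m))"
  proof (intro sum.cong refl)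
    fix m assume "m \<in> {1..i div 2}"
    then have "i = m + (i - m)" by auto
    then have "real n ^ i = real n ^ m * real n ^ (i - m)"
      by (metis power_add)
    then show "poly (central_moment_poly m i) p * real n ^ m / real n ^ i =
        poly (central_moment_poly m i) p / real n ^ (i - m)"
      using n by (simp add: field_simps)
  qed
  finally show "binomial_expectation n p (\<lambda>q. (q - p) ^ i) =
     (\<Sum>m=1..i div 2. poly (central_moment_poly m i) p / real n ^ (i - m))" .
qed

lemma is_moment_coeff_moment_coeff: "is_moment_coeff moment_coeff"
  unfolding moment_coeff_def
  by (rule someI[where P = is_moment_coeff, OF is_moment_coeff_central_moment_poly])

end

theory Submission
  imports Defs
begin

text \<open>Absolute continuity together with an almost-everywhere bound on the derivative makes the
  derivative of order \<open>2k - 1\<close> of \<open>f\<close> Lipschitz. Since \<open>t\<^sub>i\<close> is a combination of derivatives of \<open>f\<close>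
  up to order \<open>2i\<close> with polynomial coefficients, it has \<open>2(k - i) - 1\<close> derivatives, all bounded and
  the last one Lipschitz. Taylor expansion of \<open>t\<^sub>i\<close> at \<open>p\<close> to that order and the moment formula give
  \<open>E t\<^sub>i = t\<^sub>i(p) + \<Sum>\<^sub>j T\<^sub>j[t\<^sub>i](p) / n\<^sup>j\<close> over \<open>1 \<le> j < k - i\<close>, up to an error of order
  \<open>k - i\<close> in \<open>1/n\<close>. Summing over \<open>i\<close> with weights \<open>1/n\<^sup>i\<close>, the recursion for the \<open>t\<^sub>i\<close> cancels
  every coefficient except \<open>t\<^sub>0 = f\<close>.\<close>

section \<open>Increments of absolutely continuous functions\<close>

text \<open>Frees the definition from its indexing by an initial segment of the naturals: any finite
  index set is enumerated by a bijection. It is needed because the cells of a tagged division are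
  indexed by the division itself.\<close>

lemma absolutely_continuous_on_sum_small:
  assumes AC: "absolutely_continuous_on S g" and "\<epsilon> > 0"
  shows "\<exists>\<delta>>0. \<forall>I (a :: 'i \<Rightarrow> real) b. finite I \<longrightarrow>
    (\<forall>i\<in>I. a i \<le> b i \<and> {a i..b i} \<subseteq> S) \<longrightarrow> disjoint_family_on (\<lambda>i. {a i<..<b i}) I \<longrightarrow>
    (\<Sum>i\<in>I. b i - a i) < \<delta> \<longrightarrow> (\<Sum>i\<in>I. \<bar>g (b i) - g (a i)\<bar>) < \<epsilon>"
proof -
  obtain \<delta> where "\<delta> > 0" and \<delta>: "\<And>(N::nat) a b. (\<forall>i<N. a i \<le> b i \<and> {a i..b i} \<subseteq> S) \<Longrightarrow>
        disjoint_family_on (\<lambda>i. {a i<..<b i}) {..<N} \<Longrightarrow>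
        (\<Sum>i<N. b i - a i) < \<delta> \<Longrightarrow> (\<Sum>i<N. \<bar>g (b i) - g (a i)\<bar>) < \<epsilon>"
    using AC \<open>\<epsilon> > 0\<close> unfolding absolutely_continuous_on_def by meson
  show ?thesis
  proof (intro exI[of _ \<delta>] conjI allI impI \<open>\<delta> > 0\<close>)
    fix I and a b :: "'i \<Rightarrow> real"
    assume I: "finite I" and ab: "\<forall>i\<in>I. a i \<le> b i \<and> {a i..b i} \<subseteq> S"
      and disj: "disjoint_family_on (\<lambda>i. {a i<..<b i}) I" and small: "(\<Sum>i\<in>I. b i - a i) < \<delta>"
    obtain e where e: "bij_betw e {..<card I} I"
      using ex_bij_betw_nat_finite[OF I] by (auto simp: atLeast0LessThan)
    have eI: "e i \<in> I" if "i < card I" for i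
      using e that by (auto simp: bij_betw_def)
    have "(\<Sum>i<card I. \<bar>g (b (e i)) - g (a (e i))\<bar>) < \<epsilon>"
    proof (rule \<delta>)
      show "\<forall>i<card I. a (e i) \<le> b (e i) \<and> {a (e i)..b (e i)} \<subseteq> S"
        using ab eI by blast
      show "disjoint_family_on (\<lambda>i. {a (e i)<..<b (e i)}) {..<card I}"
        unfolding disjoint_family_on_def
      proof (intro ballI impI)
        fix m n assume mn: "m \<in> {..<card I}" "n \<in> {..<card I}" "m \<noteq> n"
        then have "e m \<noteq> e n" using e by (auto simp: bij_betw_def inj_on_def)
        then show "{a (e m)<..<b (e m)} \<inter> {a (e n)<..<b (e n)} = {}"
          using disj mn eI unfolding disjoint_family_on_def by (metis lessThan_iff)
      qed
      show "(\<Sum>i<card I. b (e i) - a (e i)) < \<delta>"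
        using small sum.reindex_bij_betw[OF e, of "\<lambda>i. b i - a i"] by simp
    qed
    then show "(\<Sum>i\<in>I. \<bar>g (b i) - g (a i)\<bar>) < \<epsilon>"
      using sum.reindex_bij_betw[OF e, of "\<lambda>i. \<bar>g (b i) - g (a i)\<bar>"] by simp
  qed
qed

text \<open>Cousin's lemma yields a tagged division fine enough that cells tagged outside the exceptional
  null set have slope at most \<open>L + \<epsilon>\<close>, while cells tagged inside it lie in an open set
  so small that absolute continuity makes their total increment at most \<open>\<epsilon>\<close>.\<close>

lemma absolutely_continuous_on_increment_le:
  assumes AC: "absolutely_continuous_on S g" and "a \<le> b" and abS: "{a..b} \<subseteq> S"
    and AE: "AE x in lborel. x \<in> {a..b} \<longrightarrow>
      (\<exists>D. (g has_real_derivative D) (at x within {a..b}) \<and> \<bar>D\<bar> \<le> L)"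
    and "L \<ge> 0"
  shows "\<bar>g b - g a\<bar> \<le> L * (b - a)"
proof -
  have main: "\<bar>g b - g a\<bar> \<le> (L + \<epsilon>) * (b - a) + \<epsilon>" if "\<epsilon> > 0" for \<epsilon>
  proof -
    obtain \<delta> where "\<delta> > 0" and \<delta>: "\<forall>I (a :: real \<times> real set \<Rightarrow> real) b. finite I \<longrightarrow>
       (\<forall>i\<in>I. a i \<le> b i \<and> {a i..b i} \<subseteq> S) \<longrightarrow> disjoint_family_on (\<lambda>i. {a i<..<b i}) I \<longrightarrow>
       (\<Sum>i\<in>I. b i - a i) < \<delta> \<longrightarrow> (\<Sum>i\<in>I. \<bar>g (b i) - g (a i)\<bar>) < \<epsilon>"
      using absolutely_continuous_on_sum_small[OF AC \<open>\<epsilon> > 0\<close>] by blast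
    obtain N where N: "N \<in> null_sets lborel" and
      der: "\<And>x. x \<in> {a..b} \<Longrightarrow> x \<notin> N \<Longrightarrow>
        \<exists>D. (g has_real_derivative D) (at x within {a..b}) \<and> \<bar>D\<bar> \<le> L"
      by (rule AE_E3[OF AE]) (simp del: atLeastAtMost_iff)
    have "N \<in> sets borel" using N by auto
    \<comment> \<open>Outer regularity covers \<open>N\<close> by an open set; since
      \<open>N\<close> is null, \<open>U\<close> is no larger than \<open>U - N\<close> and so has
      measure below \<delta>.\<close>
    then obtain U where U: "open U" "N \<subseteq> U" and "emeasure lborel (U - N) < \<delta>"
      using outer_regular_lborel[OF _ \<open>\<delta> > 0\<close>] by blast
    then have emU: "emeasure lborel U < \<delta>"
      using emeasure_Diff_null_set[OF N, of U] by simp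
    \<comment> \<open>Both requirements are conditional, so one radius function serves as the gauge:
      inside \<open>N\<close> it keeps cells in \<open>U\<close>, outside it controls slopes, and
      elsewhere any radius will do.\<close>
    have "\<exists>r>0. (x \<in> N \<longrightarrow> ball x r \<subseteq> U) \<and>
       (x \<in> {a..b} - N \<longrightarrow> (\<forall>y\<in>{a..b}. \<bar>y - x\<bar> < r \<longrightarrow> \<bar>g y - g x\<bar> \<le> (L + \<epsilon>) * \<bar>y - x\<bar>))" for x
    proof (cases "x \<in> N")
      case True
      then show ?thesis using U by (auto simp: open_contains_ball)
    next
      case False
      show ?thesis
      proof (cases "x \<in> {a..b}")
        case True
        with False der obtain D where "(g has_real_derivative D) (at x within {a..b})" and D: "\<bar>D\<bar> \<le> L"
          by blast
        then obtain d where "d > 0" and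
          d: "\<And>y. y \<in> {a..b} \<Longrightarrow> \<bar>y - x\<bar> < d \<Longrightarrow> \<bar>g y - g x - D * (y - x)\<bar> \<le> \<epsilon> * \<bar>y - x\<bar>"
          using \<open>\<epsilon> > 0\<close> unfolding has_field_derivative_def has_derivative_within_alt by force
        have "\<bar>g y - g x\<bar> \<le> (L + \<epsilon>) * \<bar>y - x\<bar>" if y: "y \<in> {a..b}" "\<bar>y - x\<bar> < d" for y
        proof -
          have "\<bar>g y - g x\<bar> \<le> \<epsilon> * \<bar>y - x\<bar> + \<bar>D * (y - x)\<bar>" using d[OF y] by linarith
          also have "\<bar>D * (y - x)\<bar> \<le> L * \<bar>y - x\<bar>"
            using D by (simp add: abs_mult mult_right_mono)
          finally show ?thesis by (simp add: algebra_simps)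
        qed
        with \<open>d > 0\<close> False show ?thesis by blast
      qed (use False in \<open>auto intro: exI[of _ 1]\<close>)
    qed
    then obtain r where r: "\<And>x. r x > 0" "\<And>x. x \<in> N \<Longrightarrow> ball x (r x) \<subseteq> U"
      "\<And>x y. x \<in> {a..b} - N \<Longrightarrow> y \<in> {a..b} \<Longrightarrow> \<bar>y - x\<bar> < r x \<Longrightarrow> \<bar>g y - g x\<bar> \<le> (L + \<epsilon>) * \<bar>y - x\<bar>"
      by metis
    have "gauge (\<lambda>x. ball x (r x))" using r(1) by (intro gauge_ball_dependent) auto
    then obtain P where P: "P tagged_division_of {a..b}" and fine: "(\<lambda>x. ball x (r x)) fine P"
      using fine_division_exists_real by blast
    note PD = tagged_division_ofD[OF P]
    define lo where "lo = (\<lambda>q::real \<times> real set. Inf (snd q))"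
    define hi where "hi = (\<lambda>q::real \<times> real set. Sup (snd q))"
    have cell: "snd q = {lo q..hi q} \<and> lo q \<le> fst q \<and> fst q \<le> hi q \<and> {lo q..hi q} \<subseteq> {a..b} \<and>
        {lo q..hi q} \<subseteq> ball (fst q) (r (fst q))"
      if qP: "q \<in> P" for q
    proof -
      obtain x K where q: "q = (x, K)" by force
      obtain u v where K: "K = {u..v}" using PD(4)[of x K] qP q by auto
      have x: "x \<in> K" "K \<subseteq> {a..b}" using PD(2,3)[of x K] qP q by auto
      then have "Inf K = u" "Sup K = v" using K by auto
      moreover have "K \<subseteq> ball x (r x)" using fine qP q by (auto simp: fine_def)
      ultimately show ?thesis using x K q by (auto simp: lo_def hi_def)
    qed
    have tele: "(\<Sum>q\<in>P. G (hi q) - G (lo q)) = G b - G a" for G :: "real \<Rightarrow> real"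
      using additive_tagged_division_1[OF \<open>a \<le> b\<close> P, of G] by (simp add: lo_def hi_def case_prod_unfold)
    define P1 where "P1 = {q\<in>P. fst q \<in> N}"
    have fin: "finite P" "finite P1" using PD(1) by (auto simp: P1_def)
    have disj: "disjoint_family_on (\<lambda>q. {lo q<..<hi q}) P"
      unfolding disjoint_family_on_def
    proof (intro ballI impI)
      fix q q' assume q: "q \<in> P" "q' \<in> P" "q \<noteq> q'"
      then have "interior (snd q) \<inter> interior (snd q') = {}"
        using PD(5)[of "fst q" "snd q" "fst q'" "snd q'"] by simp
      then show "{lo q<..<hi q} \<inter> {lo q'<..<hi q'} = {}"
        using cell[OF q(1)] cell[OF q(2)] by (metis interior_atLeastAtMost_real)
    qed
    then have disj1: "disjoint_family_on (\<lambda>q. {lo q<..<hi q}) P1"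
      by (rule disjoint_family_on_mono[rotated]) (auto simp: P1_def)
    have le: "lo q \<le> hi q" if "q \<in> P" for q using cell[OF that] by linarith
    \<comment> \<open>The open cells tagged in \<open>N\<close> are disjoint and contained in
      \<open>U\<close>, so their total length stays below \<delta> and absolute continuity applies
      to them.\<close>
    have "ennreal (\<Sum>q\<in>P1. hi q - lo q) = (\<Sum>q\<in>P1. emeasure lborel {lo q<..<hi q})"
      using le by (subst sum_ennreal[symmetric]) (auto simp: P1_def intro!: sum.cong)
    also have "\<dots> = emeasure lborel (\<Union>q\<in>P1. {lo q<..<hi q})"
      by (rule sum_emeasure) (use fin disj1 in auto)
    also have "\<dots> \<le> emeasure lborel U"
    proof (rule emeasure_mono)
      show "(\<Union>q\<in>P1. {lo q<..<hi q}) \<subseteq> U"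
      proof
        fix x assume "x \<in> (\<Union>q\<in>P1. {lo q<..<hi q})"
        then obtain q where q: "q \<in> P" "fst q \<in> N" "x \<in> {lo q..hi q}" by (force simp: P1_def)
        then show "x \<in> U" using cell[of q] r(2)[of "fst q"] by blast
      qed
    qed (use U in auto)
    also have "\<dots> < \<delta>" by (rule emU)
    finally have "(\<Sum>q\<in>P1. hi q - lo q) < \<delta>"
      by (meson ennreal_leI not_le)
    moreover have "\<forall>q\<in>P1. lo q \<le> hi q \<and> {lo q..hi q} \<subseteq> S"
    proof
      fix q assume "q \<in> P1"
      then have "q \<in> P" by (simp add: P1_def)
      then show "lo q \<le> hi q \<and> {lo q..hi q} \<subseteq> S"
        using le cell[of q] abS by (meson order_trans)
    qed
    ultimately have bad: "(\<Sum>q\<in>P1. \<bar>g (hi q) - g (lo q)\<bar>) < \<epsilon>"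
      using \<delta>[rule_format, of P1 lo hi] fin disj1 by blast
    have good: "\<bar>g (hi q) - g (lo q)\<bar> \<le> (L + \<epsilon>) * (hi q - lo q)" if "q \<in> P - P1" for q
    proof -
      have q: "q \<in> P" "fst q \<notin> N" using that by (auto simp: P1_def)
      have x: "fst q \<in> {a..b} - N" "hi q \<in> {a..b}" "lo q \<in> {a..b}"
        using cell[OF q(1)] q(2) by auto
      have "hi q \<in> {lo q..hi q}" "lo q \<in> {lo q..hi q}" using le[OF q(1)] by auto
      then have "hi q \<in> ball (fst q) (r (fst q))" "lo q \<in> ball (fst q) (r (fst q))"
        using cell[OF q(1)] by blast+
      then have "\<bar>hi q - fst q\<bar> < r (fst q)" "\<bar>lo q - fst q\<bar> < r (fst q)"
        by (auto simp: dist_real_def)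
      then have "\<bar>g (hi q) - g (fst q)\<bar> \<le> (L + \<epsilon>) * \<bar>hi q - fst q\<bar>"
        "\<bar>g (lo q) - g (fst q)\<bar> \<le> (L + \<epsilon>) * \<bar>lo q - fst q\<bar>"
        using r(3) x by blast+
      then have "\<bar>g (hi q) - g (lo q)\<bar> \<le> (L + \<epsilon>) * \<bar>hi q - fst q\<bar> + (L + \<epsilon>) * \<bar>lo q - fst q\<bar>"
        by linarith
      \<comment> \<open>The tag lies between the endpoints, so its distances to them add up to the
        cell length.\<close>
      also have "\<dots> = (L + \<epsilon>) * (hi q - lo q)"
        using cell[OF q(1)] by (simp add: algebra_simps)
      finally show ?thesis .
    qed
    have "\<bar>g b - g a\<bar> \<le> (\<Sum>q\<in>P. \<bar>g (hi q) - g (lo q)\<bar>)"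
      unfolding tele[of g, symmetric] by (rule sum_abs)
    also have "\<dots> = (\<Sum>q\<in>P - P1. \<bar>g (hi q) - g (lo q)\<bar>) + (\<Sum>q\<in>P1. \<bar>g (hi q) - g (lo q)\<bar>)"
      by (rule sum.subset_diff) (use fin in \<open>auto simp: P1_def\<close>)
    also have "\<dots> \<le> (\<Sum>q\<in>P - P1. (L + \<epsilon>) * (hi q - lo q)) + \<epsilon>"
      using good bad by (intro add_mono sum_mono) auto
    also have "(\<Sum>q\<in>P - P1. (L + \<epsilon>) * (hi q - lo q)) \<le> (\<Sum>q\<in>P. (L + \<epsilon>) * (hi q - lo q))"
      using fin le \<open>L \<ge> 0\<close> \<open>\<epsilon> > 0\<close> by (intro sum_mono2) auto
    also have "\<dots> = (L + \<epsilon>) * (b - a)"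
      using tele[of "\<lambda>x. x"] by (simp add: sum_distrib_left[symmetric])
    finally show ?thesis by simp
  qed
  show ?thesis
  proof (rule field_le_epsilon)
    fix e :: real assume "e > 0"
    \<comment> \<open>Chosen so that the total excess
      \<open>\<epsilon> * (b - a) + \<epsilon>\<close> equals \<open>e\<close>; the added 1 keeps
      the denominator positive when \<open>a = b\<close>.\<close>
    define \<epsilon> where "\<epsilon> = e / (b - a + 1)"
    have "\<epsilon> > 0" using \<open>e > 0\<close> \<open>a \<le> b\<close> by (simp add: \<epsilon>_def)
    have "\<epsilon> * (b - a + 1) = e" using \<open>a \<le> b\<close> by (simp add: \<epsilon>_def)
    with main[OF \<open>\<epsilon> > 0\<close>] show "\<bar>g b - g a\<bar> \<le> L * (b - a) + e"
      by (simp add: algebra_simps)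
  qed
qed

section \<open>One-sided derivatives and the passage from \<open>condition_D\<close> to
  \<open>C_lip\<close>\<close>

lemma has_real_derivative_deriv01:
  assumes "g differentiable (at x within {0..1})"
  shows "(g has_real_derivative deriv01 g x) (at x within {0..1})"
  using assms unfolding deriv01_def has_real_derivative_iff_has_vector_derivative
  by (simp add: vector_derivative_works)

lemma deriv01_eq:
  assumes "(g has_real_derivative D) (at x within {0..1})" "x \<in> {0..1}"
  shows "deriv01 g x = D"
  using assms unfolding deriv01_def has_real_derivative_iff_has_vector_derivative
  by (intro vector_derivative_within_closed_interval) auto

text \<open>The increment bound is applied on every subinterval, since a derivative within the unit
  interval restricts to one within the subinterval.\<close>

lemma absolutely_continuous_imp_lipschitz_on:
  assumes AC: "absolutely_continuous_on {0..1} g" and "L \<ge> 0"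
    and AE: "AE x in lborel. x \<in> {0..1} \<longrightarrow>
      g differentiable (at x within {0..1}) \<and> \<bar>deriv01 g x\<bar> \<le> L"
  shows "L-lipschitz_on {0..1} g"
proof (rule lipschitz_onI)
  have *: "\<bar>g b - g a\<bar> \<le> L * (b - a)" if ab: "a \<le> b" "0 \<le> a" "b \<le> 1" for a b
  proof (rule absolutely_continuous_on_increment_le[OF AC ab(1) _ _ \<open>L \<ge> 0\<close>])
    show "AE x in lborel. x \<in> {a..b} \<longrightarrow>
      (\<exists>D. (g has_real_derivative D) (at x within {a..b}) \<and> \<bar>D\<bar> \<le> L)"
      using AE
    proof eventually_elim
      case (elim x)
      show ?case
      proof
        assume "x \<in> {a..b}"
        then have "g differentiable (at x within {0..1})" "\<bar>deriv01 g x\<bar> \<le> L" using elim ab by auto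
        then show "\<exists>D. (g has_real_derivative D) (at x within {a..b}) \<and> \<bar>D\<bar> \<le> L"
          using has_field_derivative_subset[OF has_real_derivative_deriv01, of g x "{a..b}"] ab by auto
      qed
    qed
  qed (use ab in auto)
  show "dist (g x) (g y) \<le> L * dist x y" if "x \<in> {0..1}" "y \<in> {0..1}" for x y
    using *[of x y] *[of y x] that by (cases "x \<le> y") (auto simp: dist_real_def abs_minus_commute)
qed fact

text \<open>A substitute for \<open>condition_D (Suc r) B\<close> whose stability under products, unlike that of absolute
  continuity with an almost-everywhere bound, follows by an easy induction.\<close>

fun C_lip :: "nat \<Rightarrow> real \<Rightarrow> (real \<Rightarrow> real) \<Rightarrow> bool" where
  "C_lip 0 B g \<longleftrightarrow> (\<forall>x\<in>{0..1}. \<bar>g x\<bar> \<le> B) \<and> B-lipschitz_on {0..1} g"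
| "C_lip (Suc r) B g \<longleftrightarrow> (\<forall>x\<in>{0..1}. \<bar>g x\<bar> \<le> B) \<and> g differentiable_on {0..1} \<and> C_lip r B (deriv01 g)"

text \<open>\<open>C_lip\<close> peels off the innermost derivative, while \<open>nderiv01\<close>
  is phrased by adding an outermost one; commuting the iterates with \<open>funpow_Suc_right\<close>
  reconciles the two.\<close>

lemma C_lipI:
  assumes "\<And>i. i < r \<Longrightarrow> nderiv01 i g differentiable_on {0..1}"
    and "\<And>i x. i \<le> r \<Longrightarrow> x \<in> {0..1} \<Longrightarrow> \<bar>nderiv01 i g x\<bar> \<le> B"
    and "B-lipschitz_on {0..1} (nderiv01 r g)"
  shows "C_lip r B g"
  using assms
proof (induction r arbitrary: g)
  case 0
  from "0.prems"(2)[of 0] "0.prems"(3) show ?case by auto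
next
  case (Suc r)
  have "C_lip r B (deriv01 g)"
  proof (rule Suc.IH)
    show "nderiv01 i (deriv01 g) differentiable_on {0..1}" if "i < r" for i
      using Suc.prems(1)[of "Suc i"] that by (simp only: funpow_Suc_right o_apply)
    show "\<bar>nderiv01 i (deriv01 g) x\<bar> \<le> B" if "i \<le> r" "x \<in> {0..1}" for i x
      using Suc.prems(2)[of "Suc i" x] that by (simp only: funpow_Suc_right o_apply)
    show "B-lipschitz_on {0..1} (nderiv01 r (deriv01 g))"
      using Suc.prems(3) by (simp only: funpow_Suc_right o_apply)
  qed
  then show ?case using Suc.prems(1)[of 0] Suc.prems(2)[of 0] by simp
qed

text \<open>The almost-everywhere information is used up here; the rest of the argument works with
  \<open>C_lip\<close> alone.\<close>

lemma condition_D_imp_C_lip: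
  assumes D: "condition_D (Suc r) L f" and "L \<ge> 0"
  shows "C_lip r L f"
proof (rule C_lipI)
  have AE: "AE x in lborel. x \<in> {0..1} \<longrightarrow>
      nderiv01 r f differentiable (at x within {0..1}) \<and> \<bar>deriv01 (nderiv01 r f) x\<bar> \<le> L"
    using D by (simp add: condition_D_def)
  show "L-lipschitz_on {0..1} (nderiv01 r f)"
    by (rule absolutely_continuous_imp_lipschitz_on[OF _ \<open>L \<ge> 0\<close> AE])
      (use D in \<open>simp add: condition_D_def\<close>)
qed (use D in \<open>auto simp: condition_D_def\<close>)

section \<open>Closure properties of \<open>C_lip\<close>\<close>

lemma C_lip_bound: "C_lip r B g \<Longrightarrow> x \<in> {0..1} \<Longrightarrow> \<bar>g x\<bar> \<le> B"
  by (cases r) auto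

lemma C_lip_nonneg: "C_lip r B g \<Longrightarrow> 0 \<le> B"
  using C_lip_bound[of r B g 0] by simp

lemma C_lip_has_derivative:
  assumes "C_lip (Suc r) B g" "x \<in> {0..1}"
  shows "(g has_real_derivative deriv01 g x) (at x within {0..1})"
  using assms by (intro has_real_derivative_deriv01) (auto simp: differentiable_on_def)

text \<open>A derivative within the unit interval sees only values there, so functions that agree on
  the interval have the same iterated \<open>deriv01\<close> on it.\<close>

lemma C_lip_cong:
  assumes "C_lip r B g" "\<And>x. x \<in> {0..1} \<Longrightarrow> h x = g x"
  shows "C_lip r B h"
  using assms
proof (induction r arbitrary: g h)
  case 0
  then show ?case by (auto simp: lipschitz_on_def)
next
  case (Suc r)
  have der: "(h has_real_derivative deriv01 g x) (at x within {0..1})" if "x \<in> {0..1}" for x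
    by (rule has_field_derivative_transform_within[OF C_lip_has_derivative[OF Suc.prems(1) that], of 1])
      (use Suc.prems(2) that in auto)
  have "C_lip r B (deriv01 h)"
    by (rule Suc.IH[of "deriv01 g"]) (use Suc.prems deriv01_eq[OF der] in auto)
  then show ?case
    using Suc.prems der unfolding C_lip.simps differentiable_on_def real_differentiable_def
    by metis
qed

text \<open>Lets a derivative known by a formula stand in for \<open>deriv01 g\<close>.\<close>

lemma C_lip_SucI:
  assumes "\<And>x. x \<in> {0..1} \<Longrightarrow> \<bar>g x\<bar> \<le> B"
    and "\<And>x. x \<in> {0..1} \<Longrightarrow> (g has_real_derivative g' x) (at x within {0..1})"
    and "C_lip r B g'"
  shows "C_lip (Suc r) B g"
proof -
  have "C_lip r B (deriv01 g)"
    by (rule C_lip_cong[OF assms(3)]) (use deriv01_eq[OF assms(2)] in auto)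
  then show ?thesis
    using assms(1,2) unfolding C_lip.simps differentiable_on_def real_differentiable_def by blast
qed

lemma C_lip_mono: "C_lip r B g \<Longrightarrow> B \<le> B' \<Longrightarrow> C_lip r B' g"
  by (induction r arbitrary: g) (force intro: lipschitz_on_le)+

text \<open>The mean value inequality turns the bound on the derivative into a Lipschitz constant;
  higher orders reduce to this case by passing to \<open>deriv01 g\<close>.\<close>

lemma C_lip_Suc_D: "C_lip (Suc r) B g \<Longrightarrow> C_lip r B g"
proof (induction r arbitrary: g)
  case 0
  have "B-lipschitz_on {0..1} g"
  proof (rule lipschitz_onI)
    fix x y :: real assume "x \<in> {0..1}" "y \<in> {0..1}"
    then show "dist (g x) (g y) \<le> B * dist x y"
      unfolding dist_norm
      by (intro field_differentiable_bound[OF _ C_lip_has_derivative[OF 0]]) (use 0 in auto)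
  qed (rule C_lip_nonneg[OF 0])
  then show ?case using 0 by simp
next
  case (Suc r)
  then show ?case by (auto simp del: C_lip.simps(1))
qed

lemma C_lip_le: "C_lip r B g \<Longrightarrow> s \<le> r \<Longrightarrow> C_lip s B g"
  by (induction r) (auto simp: le_Suc_eq simp del: C_lip.simps dest: C_lip_Suc_D)

lemma C_lip_nderiv01: "C_lip (r + j) B g \<Longrightarrow> C_lip r B (nderiv01 j g)"
proof (induction j arbitrary: g)
  case (Suc j)
  then have "C_lip r B (nderiv01 j (deriv01 g))" by simp
  then show ?case by (simp only: funpow_Suc_right o_apply)
qed simp

lemma C_lip_add:
  assumes "C_lip r B g" "C_lip r B' h"
  shows "C_lip r (B + B') (\<lambda>x. g x + h x)"
  using assms
proof (induction r arbitrary: g h)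
  case 0
  then show ?case
    by (auto intro: lipschitz_on_add order_trans[OF abs_triangle_ineq add_mono])
next
  case (Suc r)
  show ?case
  proof (rule C_lip_SucI)
    show "C_lip r (B + B') (\<lambda>x. deriv01 g x + deriv01 h x)" using Suc by simp
    show "\<bar>g x + h x\<bar> \<le> B + B'" if "x \<in> {0..1}" for x
      using C_lip_bound[OF Suc.prems(1) that] C_lip_bound[OF Suc.prems(2) that] by linarith
  qed (intro DERIV_add C_lip_has_derivative[OF Suc.prems(1)] C_lip_has_derivative[OF Suc.prems(2)])
qed

text \<open>The Leibniz rule writes the derivative as two products of one order less, so each order
  doubles the constant. The initial factor 2 is the Lipschitz constant of a product, again from two
  terms.\<close>

lemma C_lip_mult:
  assumes "C_lip r B g" "C_lip r B' h"
  shows "C_lip r (2 ^ Suc r * (B * B')) (\<lambda>x. g x * h x)"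
  using assms
proof (induction r arbitrary: g h)
  case 0
  note nn = C_lip_nonneg[OF "0.prems"(1)] C_lip_nonneg[OF "0.prems"(2)]
  have bd: "\<bar>g x * h x\<bar> \<le> B * B'" if "x \<in> {0..1}" for x
    using 0 that nn by (auto simp: abs_mult intro!: mult_mono)
  have "\<bar>g x * h x - g y * h y\<bar> \<le> 2 * (B * B') * \<bar>x - y\<bar>" if xy: "x \<in> {0..1}" "y \<in> {0..1}" for x y
  proof -
    have "\<bar>g x * h x - g y * h y\<bar> = \<bar>g x * (h x - h y) + (g x - g y) * h y\<bar>"
      by (simp add: algebra_simps)
    also have "\<dots> \<le> \<bar>g x\<bar> * \<bar>h x - h y\<bar> + \<bar>g x - g y\<bar> * \<bar>h y\<bar>"
      by (metis abs_mult abs_triangle_ineq)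
    also have "\<dots> \<le> B * (B' * \<bar>x - y\<bar>) + (B * \<bar>x - y\<bar>) * B'"
      using 0 xy nn by (intro add_mono mult_mono) (auto simp: lipschitz_on_def dist_real_def)
    finally show ?thesis by (simp add: algebra_simps)
  qed
  moreover have "B * B' \<ge> 0" using nn by simp
  ultimately show ?case using bd
    by (auto simp: lipschitz_on_def dist_real_def intro: order_trans[OF bd])
next
  case (Suc r)
  note nn = C_lip_nonneg[OF Suc.prems(1)] C_lip_nonneg[OF Suc.prems(2)]
  show ?case
  proof (rule C_lip_SucI)
    have "C_lip r (2 ^ Suc r * (B * B') + 2 ^ Suc r * (B * B')) (\<lambda>x. deriv01 g x * h x + g x * deriv01 h x)"
      using Suc.prems C_lip_Suc_D[OF Suc.prems(1)] C_lip_Suc_D[OF Suc.prems(2)]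
      by (intro C_lip_add Suc.IH) auto
    then show "C_lip r (2 ^ Suc (Suc r) * (B * B')) (\<lambda>x. deriv01 g x * h x + g x * deriv01 h x)"
      by (simp add: mult_ac)
    show "((\<lambda>x. g x * h x) has_real_derivative deriv01 g x * h x + g x * deriv01 h x) (at x within {0..1})"
      if "x \<in> {0..1}" for x
      using DERIV_mult'[OF C_lip_has_derivative[OF Suc.prems(1) that] C_lip_has_derivative[OF Suc.prems(2) that]]
      by (simp add: add.commute)
    show "\<bar>g x * h x\<bar> \<le> 2 ^ Suc (Suc r) * (B * B')" if "x \<in> {0..1}" for x
    proof -
      have "\<bar>g x * h x\<bar> \<le> 1 * (B * B')"
        using C_lip_bound[OF Suc.prems(1) that] C_lip_bound[OF Suc.prems(2) that] nn
        by (auto simp: abs_mult intro!: mult_mono)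
      also have "\<dots> \<le> 2 ^ Suc (Suc r) * (B * B')"
        using nn by (intro mult_right_mono one_le_power) auto
      finally show ?thesis .
    qed
  qed
qed

lemma poly_bounded_01:
  fixes q :: "real poly"
  obtains B where "B \<ge> 0" "\<And>x. x \<in> {0..1} \<Longrightarrow> \<bar>poly q x\<bar> \<le> B"
proof -
  have "compact (poly q ` {0..1})"
    by (intro compact_continuous_image continuous_intros) auto
  then obtain B where "\<And>x. x \<in> {0..1} \<Longrightarrow> \<bar>poly q x\<bar> \<le> B"
    using compact_imp_bounded bounded_iff by (metis imageI real_norm_def)
  then show thesis by (intro that[of "max 0 B"]) (auto simp: le_max_iff_disj)
qed

lemma C_lip_poly: "\<exists>B. C_lip r B (poly q)"
proof (induction r arbitrary: q)
  case (Suc r)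
  obtain B where B: "\<And>x. x \<in> {0..1} \<Longrightarrow> \<bar>poly q x\<bar> \<le> B" using poly_bounded_01 by blast
  obtain B' where "C_lip r B' (poly (pderiv q))" using Suc by blast
  then have "C_lip r (max B B') (poly (pderiv q))" by (rule C_lip_mono) simp
  then have "C_lip (Suc r) (max B B') (poly q)"
    by (intro C_lip_SucI) (auto intro: has_field_derivative_at_within poly_DERIV simp: le_max_iff_disj B)
  then show ?case by blast
next
  case 0
  obtain B where B: "\<And>x. x \<in> {0..1} \<Longrightarrow> \<bar>poly q x\<bar> \<le> B" using poly_bounded_01 by blast
  obtain B' where B': "B' \<ge> 0" "\<And>x. x \<in> {0..1} \<Longrightarrow> \<bar>poly (pderiv q) x\<bar> \<le> B'" using poly_bounded_01 by blast
  have "B'-lipschitz_on {0..1} (poly q)"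
  proof (rule lipschitz_onI)
    fix x y :: real assume "x \<in> {0..1}" "y \<in> {0..1}"
    then show "dist (poly q x) (poly q y) \<le> B' * dist x y"
      unfolding dist_norm
      by (intro field_differentiable_bound[of "{0..1}" _ "poly (pderiv q)"])
        (auto intro: has_field_derivative_at_within poly_DERIV simp: B')
  qed fact
  then have "C_lip 0 (max B B') (poly q)"
    by (auto intro: lipschitz_on_le simp: le_max_iff_disj B)
  then show ?case by blast
qed

text \<open>The factor \<open>K\<close> precedes \<open>B\<close> and \<open>g\<close> and the bound
  is linear in \<open>B\<close>. This uniformity is carried through to the final constant.\<close>

lemma C_lip_poly_mult: "\<exists>K\<ge>0. \<forall>B g. C_lip r B g \<longrightarrow> C_lip r (K * B) (\<lambda>x. poly q x * g x)"
proof -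
  obtain A where A: "C_lip r A (poly q)" using C_lip_poly by blast
  show ?thesis
  proof (intro exI[of _ "2 ^ Suc r * A"] conjI allI impI)
    show "0 \<le> 2 ^ Suc r * A" using C_lip_nonneg[OF A] by simp
    show "C_lip r (2 ^ Suc r * A * B) (\<lambda>x. poly q x * g x)" if "C_lip r B g" for B g
      using C_lip_mult[OF A that] by (simp add: mult.assoc)
  qed
qed

lemma C_lip_zero: "C_lip r 0 (\<lambda>x. 0)"
  by (induction r) (auto intro!: C_lip_SucI[where g' = "\<lambda>x. 0"] simp: lipschitz_on_def simp del: C_lip.simps(2))

lemma C_lip_sum:
  assumes "finite I" "\<And>i. i \<in> I \<Longrightarrow> C_lip r (B i) (g i)"
  shows "C_lip r (\<Sum>i\<in>I. B i) (\<lambda>x. \<Sum>i\<in>I. g i x)"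
  using assms by (induction I rule: finite_induct) (auto intro: C_lip_zero C_lip_add)

section \<open>Regularity of \<open>taylor_T\<close> and \<open>taylor_t\<close>\<close>

text \<open>The operator is a polynomial combination of derivatives of order at most
  \<open>2 * j\<close>, so it costs at most that many orders.\<close>

lemma C_lip_taylor_T:
  "\<exists>K\<ge>0. \<forall>B g. C_lip (r + 2 * j) B g \<longrightarrow> C_lip r (K * B) (taylor_T j g)"
proof -
  \<comment> \<open>The factorial is absorbed into the polynomial, so each summand is one polynomial
    times one derivative.\<close>
  have "\<forall>i. \<exists>K\<ge>0. \<forall>B g. C_lip r B g \<longrightarrow>
    C_lip r (K * B) (\<lambda>x. poly (smult (1 / fact i) (moment_coeff (i - j) i)) x * g x)"
    using C_lip_poly_mult by blast
  then obtain K where K: "\<And>i. K i \<ge> 0" "\<And>i B g. C_lip r B g \<Longrightarrow>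
    C_lip r (K i * B) (\<lambda>x. poly (smult (1 / fact i) (moment_coeff (i - j) i)) x * g x)"
    by metis
  show ?thesis
  proof (intro exI[of _ "\<Sum>i=j+1..2*j. K i"] conjI allI impI)
    fix B g assume g: "C_lip (r + 2 * j) B g"
    have "C_lip r (\<Sum>i=j+1..2*j. K i * B) (\<lambda>x. \<Sum>i=j+1..2*j.
        poly (smult (1 / fact i) (moment_coeff (i - j) i)) x * nderiv01 i g x)"
    proof (intro C_lip_sum K C_lip_nderiv01)
      show "C_lip (r + i) B g" if "i \<in> {j+1..2*j}" for i
        using C_lip_le[OF g, of "r + i"] that by simp
    qed simp
    then show "C_lip r ((\<Sum>i=j+1..2*j. K i) * B) (taylor_T j g)"
      unfolding sum_distrib_right[symmetric]
      by (rule C_lip_cong) (simp add: taylor_T_def mult.commute)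
  qed (simp add: sum_nonneg K)
qed

lemma taylor_t_rec:
  "i \<ge> 1 \<Longrightarrow> taylor_t f i p = - (\<Sum>j=1..i. taylor_T j (taylor_t f (i - j)) p)"
  by (cases i) auto

text \<open>Strong induction on \<open>i\<close>: \<open>taylor_T j\<close> costs
  \<open>2 * j\<close> orders and \<open>taylor_t f (i - j)\<close> costs
  \<open>2 * (i - j)\<close>, so every summand of the recursion costs \<open>2 * i\<close>.\<close>

lemma C_lip_taylor_t:
  "\<exists>K\<ge>0. \<forall>B f. C_lip (r + 2 * i) B f \<longrightarrow> C_lip r (K * B) (taylor_t f i)"
proof (induction i arbitrary: r rule: less_induct)
  case (less i)
  show ?case
  proof (cases "i = 0")
    case True
    then show ?thesis by (intro exI[of _ 1]) auto
  next
    case False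
    have "\<exists>K\<ge>0. \<forall>B f. C_lip (r + 2 * i) B f \<longrightarrow> C_lip r (K * B) (taylor_T j (taylor_t f (i - j)))"
      if j: "j \<in> {1..i}" for j
    proof -
      obtain K1 where K1: "K1 \<ge> 0" "\<And>B g. C_lip (r + 2 * j) B g \<Longrightarrow> C_lip r (K1 * B) (taylor_T j g)"
        using C_lip_taylor_T[of r j] by blast
      obtain K2 where K2: "K2 \<ge> 0" "\<And>B f. C_lip (r + 2 * j + 2 * (i - j)) B f \<Longrightarrow>
          C_lip (r + 2 * j) (K2 * B) (taylor_t f (i - j))"
        using less.IH[of "i - j" "r + 2 * j"] j by auto
      have "r + 2 * j + 2 * (i - j) = r + 2 * i" using j by auto
      then have "C_lip r (K1 * K2 * B) (taylor_T j (taylor_t f (i - j)))" if "C_lip (r + 2 * i) B f" for B f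
        using K1(2)[OF K2(2)] that by (metis mult.assoc)
      then show ?thesis using K1(1) K2(1) by (intro exI[of _ "K1 * K2"]) auto
    qed
    then obtain K where K: "\<And>j. j \<in> {1..i} \<Longrightarrow> K j \<ge> 0"
      "\<And>j B f. j \<in> {1..i} \<Longrightarrow> C_lip (r + 2 * i) B f \<Longrightarrow>
        C_lip r (K j * B) (taylor_T j (taylor_t f (i - j)))"
      by metis
    \<comment> \<open>The constant polynomial -1 supplies the minus sign of the recursion.\<close>
    obtain A where A: "A \<ge> 0" "\<And>B g. C_lip r B g \<Longrightarrow> C_lip r (A * B) (\<lambda>x. poly [:-1:] x * g x)"
      using C_lip_poly_mult by metis
    show ?thesis
    proof (intro exI[of _ "A * (\<Sum>j=1..i. K j)"] conjI allI impI)
      fix B f assume "C_lip (r + 2 * i) B f"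
      then have "C_lip r (A * (\<Sum>j=1..i. K j * B))
          (\<lambda>x. poly [:-1:] x * (\<Sum>j=1..i. taylor_T j (taylor_t f (i - j)) x))"
        by (intro A C_lip_sum K) auto
      then show "C_lip r (A * (\<Sum>j=1..i. K j) * B) (taylor_t f i)"
        unfolding sum_distrib_right[symmetric] mult.assoc
        by (rule C_lip_cong) (use False in \<open>simp add: taylor_t_rec\<close>)
    qed (use A(1) K(1) in \<open>auto intro!: mult_nonneg_nonneg sum_nonneg\<close>)
  qed
qed

section \<open>Taylor expansion with a Lipschitz top derivative\<close>

text \<open>The derivative of the remainder of \<open>g\<close> is the remainder of
  \<open>deriv01 g\<close> of one order less, so the mean value inequality gains a factor
  \<open>\<bar>q - p\<bar>\<close> per step, starting from the Lipschitz bound.\<close>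

lemma C_lip_taylor_bound:
  assumes "C_lip r B g" "p \<in> {0..1}" "q \<in> {0..1}"
  shows "\<bar>g q - (\<Sum>l\<le>r. nderiv01 l g p / fact l * (q - p) ^ l)\<bar> \<le> B * \<bar>q - p\<bar> ^ Suc r"
  using assms
proof (induction r arbitrary: g q)
  case 0
  then show ?case by (auto simp: lipschitz_on_def dist_real_def)
next
  case (Suc r)
  define R where "R = (\<lambda>x. g x - (\<Sum>l\<le>Suc r. nderiv01 l g p / fact l * (x - p) ^ l))"
  define R' where "R' = (\<lambda>x. deriv01 g x - (\<Sum>l\<le>r. nderiv01 l (deriv01 g) p / fact l * (x - p) ^ l))"
  have nn: "B \<ge> 0" by (rule C_lip_nonneg[OF Suc.prems(1)])
  \<comment> \<open>The constant term is split off so that differentiation lowers every remaining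
    exponent by one.\<close>
  have R: "R x = g x - g p - (\<Sum>l\<le>r. nderiv01 l (deriv01 g) p / fact (Suc l) * (x - p) ^ Suc l)" for x
    unfolding R_def sum.atMost_Suc_shift funpow_Suc_right by simp
  have der: "(R has_real_derivative R' x) (at x within {0..1})" if "x \<in> {0..1}" for x
  proof -
    have "((\<lambda>x. nderiv01 l (deriv01 g) p / fact (Suc l) * (x - p) ^ Suc l) has_real_derivative
       nderiv01 l (deriv01 g) p / fact l * (x - p) ^ l) (at x within {0..1})" for l
    proof -
      have "((\<lambda>x. (x - p) ^ Suc l) has_real_derivative real (Suc l) * (x - p) ^ l) (at x within {0..1})"
        by (auto intro!: derivative_eq_intros simp del: power_Suc)
      from DERIV_cmult[OF this, of "nderiv01 l (deriv01 g) p / fact (Suc l)"]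
      show ?thesis by (simp add: field_simps del: of_nat_Suc power_Suc)
    qed
    then have "((\<lambda>x. \<Sum>l\<le>r. nderiv01 l (deriv01 g) p / fact (Suc l) * (x - p) ^ Suc l) has_real_derivative
       (\<Sum>l\<le>r. nderiv01 l (deriv01 g) p / fact l * (x - p) ^ l)) (at x within {0..1})"
      by (intro DERIV_sum)
    from DERIV_diff[OF DERIV_diff[OF C_lip_has_derivative[OF Suc.prems(1) that] DERIV_const] this]
    show ?thesis unfolding R R'_def by simp
  qed
  \<comment> \<open>On the segment between \<open>p\<close> and \<open>q\<close> the distance to
    \<open>p\<close> never exceeds \<open>\<bar>q - p\<bar>\<close>.\<close>
  define S where "S = {min p q..max p q}"
  have S: "S \<subseteq> {0..1}" using Suc.prems by (auto simp: S_def)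
  have "norm (R q - R p) \<le> (B * \<bar>q - p\<bar> ^ Suc r) * norm (q - p)"
  proof (rule field_differentiable_bound[of S])
    show "convex S" by (simp add: S_def)
    show "(R has_real_derivative R' x) (at x within S)" if "x \<in> S" for x
      using der[of x] that S by (meson has_field_derivative_subset subsetD)
    show "norm (R' x) \<le> B * \<bar>q - p\<bar> ^ Suc r" if "x \<in> S" for x
    proof -
      have "norm (R' x) \<le> B * \<bar>x - p\<bar> ^ Suc r"
        unfolding R'_def real_norm_def by (rule Suc.IH) (use Suc.prems that S in auto)
      also have "\<dots> \<le> B * \<bar>q - p\<bar> ^ Suc r"
        using that nn by (intro mult_left_mono power_mono) (auto simp: S_def)
      finally show ?thesis .
    qed
  qed (auto simp: S_def)
  moreover have "R p = 0" by (simp add: R)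
  ultimately show ?case by (simp add: R_def mult_ac del: sum.atMost_Suc)
qed


section \<open>Binomial expectations expanded in powers of 1/n\<close>

lemma binomial_expectation_eq_sum:
  assumes "p \<in> {0..1}"
  shows "binomial_expectation n p g = (\<Sum>x\<le>n. pmf (binomial_pmf n p) x * g (real x / real n))"
proof -
  have "binomial_expectation n p g = (\<Sum>x\<le>n. g (real x / real n) * pmf (binomial_pmf n p) x)"
    unfolding binomial_expectation_def using assms
    by (intro integral_measure_pmf_real) (auto simp: set_pmf_binomial_eq split: if_splits)
  then show ?thesis by (simp add: mult.commute)
qed

lemma binomial_expectation_diff:
  assumes "p \<in> {0..1}"
  shows "binomial_expectation n p (\<lambda>q. g q - h q) = binomial_expectation n p g - binomial_expectation n p h"
  by (simp add: binomial_expectation_eq_sum[OF assms] right_diff_distrib sum_subtractf)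

lemma binomial_expectation_linear:
  assumes "p \<in> {0..1}"
  shows "binomial_expectation n p (\<lambda>q. \<Sum>i\<in>I. c i * g i q) = (\<Sum>i\<in>I. c i * binomial_expectation n p (g i))"
  unfolding binomial_expectation_eq_sum[OF assms] sum_distrib_left
  by (subst sum.swap) (simp add: mult_ac)

lemma binomial_expectation_abs_le:
  assumes "p \<in> {0..1}" "\<And>q. q \<in> {0..1} \<Longrightarrow> \<bar>g q\<bar> \<le> h q"
  shows "\<bar>binomial_expectation n p g\<bar> \<le> binomial_expectation n p h"
proof -
  have "\<bar>binomial_expectation n p g\<bar> \<le> (\<Sum>x\<le>n. \<bar>pmf (binomial_pmf n p) x * g (real x / real n)\<bar>)"
    unfolding binomial_expectation_eq_sum[OF assms(1)] by (rule sum_abs)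
  also have "\<dots> \<le> (\<Sum>x\<le>n. pmf (binomial_pmf n p) x * h (real x / real n))"
  proof (rule sum_mono)
    fix x assume "x \<in> {..n}"
    \<comment> \<open>For \<open>n = 0\<close> the quotient is 0 by convention, which is still in
      the interval.\<close>
    then have "real x / real n \<in> {0..1}" by (auto simp: divide_le_eq_1)
    from assms(2)[OF this]
    show "\<bar>pmf (binomial_pmf n p) x * g (real x / real n)\<bar> \<le> pmf (binomial_pmf n p) x * h (real x / real n)"
      by (simp add: abs_mult mult_left_mono)
  qed
  finally show ?thesis by (simp add: binomial_expectation_eq_sum[OF assms(1)])
qed

lemma binomial_expectation_central_power:
  assumes "i \<ge> 1" "n \<ge> 1" "p \<in> {0..1}"
  shows "binomial_expectation n p (\<lambda>q. (q - p) ^ i) =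
    (\<Sum>m=1..i div 2. poly (moment_coeff m i) p / real n ^ (i - m))"
  using is_moment_coeff_moment_coeff assms unfolding is_moment_coeff_def by blast

lemma divide_power_le_divide_power:
  fixes n :: nat
  assumes "n \<ge> 1" "u \<le> v" "\<bar>x\<bar> \<le> y"
  shows "\<bar>x / real n ^ v\<bar> \<le> y / real n ^ u"
  unfolding abs_divide using assms by (intro frac_le) (auto intro: power_increasing)

text \<open>The pair \<open>(i, m)\<close> contributes to order \<open>i - m\<close> in \<open>1/n\<close>: grouping by \<open>j = i - m\<close>
  gives \<open>taylor_T j\<close> for \<open>j < u\<close>, and every other pair is negligible.\<close>

lemma sum_moments_regroup:
  fixes d :: "nat \<Rightarrow> nat \<Rightarrow> real"
  shows "(\<Sum>(i, m)\<in>{(i, m). (i, m) \<in> Sigma {1..2*u-1} (\<lambda>i. {1..i div 2}) \<and> i - m < u}. d i m) =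
    (\<Sum>j=1..<u. \<Sum>i=j+1..2*j. d i (i - j))"
  unfolding sum.Sigma[OF finite_atLeastLessThan ballI[OF finite_atLeastAtMost]]
  by (rule sum.reindex_bij_witness[where i = "\<lambda>(j, i). (i, i - j)" and j = "\<lambda>(i, m). (i - m, i)"]) auto

text \<open>Taylor expansion to order \<open>2 * u - 1\<close> leaves a remainder governed by the
  central moment of order \<open>2 * u\<close>, whose terms have powers of 1/n between
  \<open>u\<close> and \<open>2 * u - 1\<close>. Every index \<open>i \<le> 2 * j\<close> with
  \<open>j < u\<close> is within the expansion, so each \<open>taylor_T j\<close> appears
  complete.\<close>

lemma binomial_expectation_expansion:
  assumes "u \<ge> 1"
  shows "\<exists>K\<ge>0. \<forall>B g n p. C_lip (2 * u - 1) B g \<longrightarrow> n \<ge> 1 \<longrightarrow> p \<in> {0..1} \<longrightarrow>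
    \<bar>binomial_expectation n p g - (g p + (\<Sum>j=1..<u. taylor_T j g p / real n ^ j))\<bar> \<le> K * B / real n ^ u"
proof -
  have "\<forall>m i. \<exists>H\<ge>0. \<forall>x\<in>{0..1}. \<bar>poly (moment_coeff m i) x\<bar> \<le> H"
    using poly_bounded_01 by metis
  then obtain H where H: "\<And>m i. H m i \<ge> 0"
    "\<And>m i x. x \<in> {0..1} \<Longrightarrow> \<bar>poly (moment_coeff m i) x\<bar> \<le> H m i" by metis
  define r where "r = 2 * u - 1"
  have Suc_r: "Suc r = 2 * u" using assms by (simp add: r_def)
  define Q where "Q = Sigma {1..2*u-1} (\<lambda>i. {1..i div 2})"
  define Q1 where "Q1 = {(i, m). (i, m) \<in> Q \<and> i - m < u}"
  \<comment> \<open>\<open>K1\<close> accounts for the Taylor remainder; \<open>K2\<close> covers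
    the moment terms of order at least \<open>u\<close>, estimated crudely by summing over all of
    \<open>Q\<close>.\<close>
  define K1 where "K1 = (\<Sum>m=1..u. H m (2 * u))"
  define K2 where "K2 = (\<Sum>(i, m)\<in>Q. H m i)"
  have fin: "finite Q" "Q1 \<subseteq> Q" by (auto simp: Q_def Q1_def)
  show ?thesis
  proof (intro exI[of _ "K1 + K2"] conjI allI impI)
    show "K1 + K2 \<ge> 0" by (auto simp: K1_def K2_def H intro!: add_nonneg_nonneg sum_nonneg)
    fix B g and p :: real and n :: nat
    assume g: "C_lip (2 * u - 1) B g" and n: "n \<ge> 1" and p: "p \<in> {0..1}"
    have B: "B \<ge> 0" by (rule C_lip_nonneg[OF g])
    define c where "c l = nderiv01 l g p / fact l" for l
    have c: "\<bar>c l\<bar> \<le> B" if "l \<le> r" for l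
    proof -
      have "C_lip (r - l) B (nderiv01 l g)"
        by (rule C_lip_nderiv01) (use g that in \<open>simp add: r_def[symmetric] del: One_nat_def\<close>)
      then have "\<bar>nderiv01 l g p\<bar> \<le> B" using p by (rule C_lip_bound)
      then have "\<bar>nderiv01 l g p\<bar> / fact l \<le> B / 1" using B by (intro frac_le) auto
      then show ?thesis by (simp add: c_def)
    qed
    define d where "d i m = c i * (poly (moment_coeff m i) p / real n ^ (i - m))" for i m
    \<comment> \<open>The exponent \<open>2 * u\<close> is even, so the absolute value disappears
      and the moment formula applies. The one-term sum lets
      \<open>binomial_expectation_linear\<close> pull out \<open>B\<close>.\<close>
    have "\<bar>binomial_expectation n p (\<lambda>q. g q - (\<Sum>l\<le>r. c l * (q - p) ^ l))\<bar> \<le>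
        binomial_expectation n p (\<lambda>q. \<Sum>l\<in>{0::nat}. B * (q - p) ^ (2 * u))"
    proof (rule binomial_expectation_abs_le[OF p])
      show "\<bar>g q - (\<Sum>l\<le>r. c l * (q - p) ^ l)\<bar> \<le> (\<Sum>l\<in>{0::nat}. B * (q - p) ^ (2 * u))" if "q \<in> {0..1}" for q
        using C_lip_taylor_bound[OF g p that] Suc_r unfolding c_def r_def[symmetric]
        by (simp add: power_even_abs)
    qed
    also have "\<dots> = B * (\<Sum>m=1..u. poly (moment_coeff m (2 * u)) p / real n ^ (2 * u - m))"
      unfolding binomial_expectation_linear[OF p] using assms n p
      by (simp add: binomial_expectation_central_power)
    also have "\<dots> \<le> B * (\<Sum>m=1..u. H m (2 * u) / real n ^ u)"
    proof (intro mult_left_mono sum_mono B)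
      fix m assume "m \<in> {1..u}"
      then show "poly (moment_coeff m (2 * u)) p / real n ^ (2 * u - m) \<le> H m (2 * u) / real n ^ u"
        by (intro order_trans[OF abs_ge_self divide_power_le_divide_power] H n p) auto
    qed
    also have "\<dots> = K1 * B / real n ^ u" by (simp add: K1_def sum_divide_distrib[symmetric])
    finally have rem: "\<bar>binomial_expectation n p g - (\<Sum>l\<le>r. c l * binomial_expectation n p (\<lambda>q. (q - p) ^ l))\<bar>
        \<le> K1 * B / real n ^ u"
      unfolding binomial_expectation_diff[OF p] binomial_expectation_linear[OF p] .
    \<comment> \<open>The moment formula starts at exponent 1; the zeroth term contributes exactly
      \<open>g p\<close>.\<close>
    have "{..r} = insert 0 {1..r}" by auto
    then have "(\<Sum>l\<le>r. c l * binomial_expectation n p (\<lambda>q. (q - p) ^ l)) =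
        g p + (\<Sum>l=1..r. c l * binomial_expectation n p (\<lambda>q. (q - p) ^ l))"
      by (simp add: c_def binomial_expectation_def)
    also have "(\<Sum>l=1..r. c l * binomial_expectation n p (\<lambda>q. (q - p) ^ l)) =
        (\<Sum>l=1..r. \<Sum>m=1..l div 2. d l m)"
      using n p by (intro sum.cong refl) (simp add: binomial_expectation_central_power d_def sum_distrib_left)
    also have "\<dots> = (\<Sum>(i, m)\<in>Q. d i m)"
      unfolding Q_def r_def by (rule sum.Sigma) auto
    also have "\<dots> = (\<Sum>(i, m)\<in>Q - Q1. d i m) + (\<Sum>(i, m)\<in>Q1. d i m)"
      by (rule sum.subset_diff) (use fin in auto)
    also have "(\<Sum>(i, m)\<in>Q1. d i m) = (\<Sum>j=1..<u. \<Sum>i=j+1..2*j. d i (i - j))"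
      unfolding Q1_def Q_def by (rule sum_moments_regroup)
    also have "\<dots> = (\<Sum>j=1..<u. taylor_T j g p / real n ^ j)"
      unfolding taylor_T_def sum_divide_distrib by (intro sum.cong refl) (auto simp: d_def c_def)
    finally have expand: "(\<Sum>l\<le>r. c l * binomial_expectation n p (\<lambda>q. (q - p) ^ l)) =
      g p + (\<Sum>j=1..<u. taylor_T j g p / real n ^ j) + (\<Sum>(i, m)\<in>Q - Q1. d i m)" by simp
    have "\<bar>\<Sum>(i, m)\<in>Q - Q1. d i m\<bar> \<le> (\<Sum>(i, m)\<in>Q - Q1. \<bar>d i m\<bar>)"
      unfolding case_prod_unfold by (rule sum_abs)
    also have "\<dots> \<le> (\<Sum>(i, m)\<in>Q - Q1. B * (H m i / real n ^ u))"
    proof (intro sum_mono, clarify)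
      fix i m assume "(i, m) \<in> Q" "(i, m) \<notin> Q1"
      then have "i \<le> r" "u \<le> i - m" by (auto simp: Q_def Q1_def r_def)
      then show "\<bar>d i m\<bar> \<le> B * (H m i / real n ^ u)"
        unfolding d_def abs_mult by (intro mult_mono c divide_power_le_divide_power n H p B) auto
    qed
    also have "\<dots> \<le> (\<Sum>(i, m)\<in>Q. B * (H m i / real n ^ u))"
      using fin B H by (intro sum_mono2) auto
    also have "\<dots> = K2 * B / real n ^ u"
      by (simp add: K2_def case_prod_unfold sum_divide_distrib[symmetric] sum_distrib_left[symmetric])
    finally have "\<bar>\<Sum>(i, m)\<in>Q - Q1. d i m\<bar> \<le> K2 * B / real n ^ u" .
    with rem show "\<bar>binomial_expectation n p g - (g p + (\<Sum>j=1..<u. taylor_T j g p / real n ^ j))\<bar>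
        \<le> (K1 + K2) * B / real n ^ u"
      unfolding expand by (simp add: distrib_right add_divide_distrib)
  qed
qed

section \<open>Cancellation of orders and the bias bound\<close>

text \<open>Truncating the expansion of \<open>taylor_t f i\<close> below order \<open>k - i\<close>
  leaves the triangle \<open>i + j < k\<close>. On each diagonal \<open>i + j = s\<close> with
  \<open>s > 0\<close> the recursion defining \<open>taylor_t f s\<close> makes the sum
  vanish.\<close>

lemma taylor_t_telescope:
  assumes "k \<ge> 1"
  shows "(\<Sum>i<k. 1 / real n ^ i * (taylor_t f i p + (\<Sum>j=1..<k - i. taylor_T j (taylor_t f i) p / real n ^ j))) = f p"
proof -
  \<comment> \<open>\<open>taylor_T 0\<close> is an empty sum, so the identity takes its place at
    \<open>j = 0\<close>.\<close>
  define A where "A i j = (if j = 0 then taylor_t f i p else taylor_T j (taylor_t f i) p) / real n ^ (i + j)" for i j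
  have "1 / real n ^ i * (taylor_t f i p + (\<Sum>j=1..<k - i. taylor_T j (taylor_t f i) p / real n ^ j)) =
      (\<Sum>j<k - i. A i j)" if "i < k" for i
  proof -
    have "{..<k - i} = insert 0 {1..<k - i}" using that by auto
    then show ?thesis by (simp add: A_def distrib_left sum_distrib_left power_add)
  qed
  then have "(\<Sum>i<k. 1 / real n ^ i * (taylor_t f i p + (\<Sum>j=1..<k - i. taylor_T j (taylor_t f i) p / real n ^ j))) =
      (\<Sum>i<k. \<Sum>j<k - i. A i j)" by simp
  also have "\<dots> = (\<Sum>(i, j)\<in>Sigma {..<k} (\<lambda>i. {..<k - i}). A i j)"
    by (rule sum.Sigma) auto
  also have "Sigma {..<k} (\<lambda>i. {..<k - i}) = {(i, j). i + j < k}" by auto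
  also have "(\<Sum>(i, j)\<in>{(i, j). i + j < k}. A i j) = (\<Sum>s<k. \<Sum>i\<le>s. A i (s - i))"
    by (rule sum.triangle_reindex)
  also have "\<dots> = (\<Sum>s<k. if s = 0 then f p else 0)"
  proof (intro sum.cong refl)
    fix s
    show "(\<Sum>i\<le>s. A i (s - i)) = (if s = 0 then f p else 0)"
    proof (cases "s = 0")
      case False
      have "(\<Sum>i\<le>s. A i (s - i)) = A s 0 + (\<Sum>i<s. A i (s - i))"
        by (simp add: lessThan_Suc_atMost[symmetric])
      also have "(\<Sum>i<s. A i (s - i)) = (\<Sum>j=1..s. A (s - j) j)"
        by (rule sum.reindex_bij_witness[where i = "\<lambda>j. s - j" and j = "\<lambda>i. s - i"]) auto
      also have "\<dots> = (\<Sum>j=1..s. taylor_T j (taylor_t f (s - j)) p) / real n ^ s"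
        unfolding sum_divide_distrib by (intro sum.cong refl) (auto simp: A_def)
      also have "A s 0 + \<dots> = 0"
        using False by (simp add: A_def taylor_t_rec)
      finally show ?thesis using False by simp
    qed (simp add: A_def)
  qed
  also have "\<dots> = f p" using assms by (simp add: sum.delta)
  finally show ?thesis .
qed

theorem theorem9:
  fixes k :: nat and L :: real
  assumes "k \<ge> 1" and "L > 0"
  shows "\<exists>M::real. \<forall>f. condition_D (2 * k) L f \<longrightarrow>
           (\<forall>n::nat. n \<ge> 1 \<longrightarrow>
              (SUP p\<in>{0..1}. ereal \<bar>binomial_expectation n p (taylor_estimator f k n) - f p\<bar>)
                \<le> ereal (M / real n ^ k))"
proof -
  \<comment> \<open>For \<open>i < k\<close> the order required of \<open>f\<close> is
    \<open>2 * k - 1\<close> regardless of \<open>i\<close>, and \<open>taylor_t f i\<close> keeps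
    just enough orders for an expansion with \<open>u = k - i\<close>.\<close>
  have "\<forall>i. \<exists>K\<ge>0. \<forall>B f. C_lip (2 * (k - i) - 1 + 2 * i) B f \<longrightarrow> C_lip (2 * (k - i) - 1) (K * B) (taylor_t f i)"
    using C_lip_taylor_t by blast
  then obtain K1 where K1: "\<And>i. K1 i \<ge> 0" "\<And>i B f. C_lip (2 * (k - i) - 1 + 2 * i) B f \<Longrightarrow>
      C_lip (2 * (k - i) - 1) (K1 i * B) (taylor_t f i)" by metis
  define bound where "bound u K \<longleftrightarrow> (\<forall>B g n p. C_lip (2 * u - 1) B g \<longrightarrow> n \<ge> 1 \<longrightarrow> p \<in> {0..1} \<longrightarrow>
    \<bar>binomial_expectation n p g - (g p + (\<Sum>j=1..<u. taylor_T j g p / real n ^ j))\<bar> \<le> K * B / real n ^ u)"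
    for u K
  have "\<exists>K. bound u K" if "u \<ge> 1" for u
    using binomial_expectation_expansion[OF that] unfolding bound_def by blast
  then obtain K2 where "\<And>u. u \<ge> 1 \<Longrightarrow> bound u (K2 u)"
    by metis
  then have K2: "\<bar>binomial_expectation n p g - (g p + (\<Sum>j=1..<u. taylor_T j g p / real n ^ j))\<bar> \<le> K2 u * B / real n ^ u"
    if "u \<ge> 1" "C_lip (2 * u - 1) B g" "n \<ge> 1" "p \<in> {0..1}" for u B g n p
    using that unfolding bound_def by blast
  \<comment> \<open>\<open>K1\<close> and \<open>K2\<close> were chosen before \<open>f\<close>,
    \<open>n\<close> and \<open>p\<close>, so \<open>M\<close> depends on \<open>k\<close> and
    \<open>L\<close> only.\<close>
  define M where "M = (\<Sum>i<k. K2 (k - i) * (K1 i * L))"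
  show ?thesis
  proof (intro exI[of _ M] allI impI SUP_least)
    fix f n p assume D: "condition_D (2 * k) L f" and n: "n \<ge> (1::nat)" and p: "p \<in> {0..1::real}"
    have "Suc (2 * k - 1) = 2 * k" using \<open>k \<ge> 1\<close> by simp
    then have f: "C_lip (2 * k - 1) L f"
      using condition_D_imp_C_lip[of "2 * k - 1" L f] D \<open>L > 0\<close> by simp
    \<comment> \<open>The expansion error of \<open>taylor_t f i\<close> has order
      \<open>k - i\<close>; its weight \<open>1 / real n ^ i\<close> raises every error to order
      \<open>k\<close>.\<close>
    define R where "R i = binomial_expectation n p (taylor_t f i) -
      (taylor_t f i p + (\<Sum>j=1..<k - i. taylor_T j (taylor_t f i) p / real n ^ j))" for i
    have R: "\<bar>R i\<bar> \<le> K2 (k - i) * (K1 i * L) / real n ^ (k - i)" if "i < k" for i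
      unfolding R_def
    proof (intro K2 n p K1)
      have "2 * (k - i) - 1 + 2 * i = 2 * k - 1" using that by auto
      then show "C_lip (2 * (k - i) - 1 + 2 * i) L f" using f by simp
    qed (use that in auto)
    have "binomial_expectation n p (taylor_estimator f k n) =
        (\<Sum>i<k. 1 / real n ^ i * binomial_expectation n p (taylor_t f i))"
      unfolding taylor_estimator_def[abs_def] by (rule binomial_expectation_linear[OF p])
    also have "\<dots> = (\<Sum>i<k. 1 / real n ^ i * R i) + f p"
      unfolding taylor_t_telescope[OF \<open>k \<ge> 1\<close>, of n f p, symmetric] sum.distrib[symmetric] R_def
      by (simp add: algebra_simps)
    finally have "\<bar>binomial_expectation n p (taylor_estimator f k n) - f p\<bar> = \<bar>\<Sum>i<k. 1 / real n ^ i * R i\<bar>"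
      by simp
    also have "\<dots> \<le> (\<Sum>i<k. \<bar>1 / real n ^ i * R i\<bar>)" by (rule sum_abs)
    also have "\<dots> \<le> (\<Sum>i<k. K2 (k - i) * (K1 i * L) / real n ^ k)"
    proof (rule sum_mono)
      fix i assume "i \<in> {..<k}"
      then have i: "i < k" by simp
      have "\<bar>1 / real n ^ i * R i\<bar> \<le> 1 / real n ^ i * (K2 (k - i) * (K1 i * L) / real n ^ (k - i))"
        unfolding abs_mult using R[OF i] by (intro mult_mono) auto
      also have "\<dots> = K2 (k - i) * (K1 i * L) / real n ^ (i + (k - i))"
        by (simp add: power_add)
      finally show "\<bar>1 / real n ^ i * R i\<bar> \<le> K2 (k - i) * (K1 i * L) / real n ^ k"
        using i by simp
    qed
    also have "\<dots> = M / real n ^ k" by (simp add: M_def sum_divide_distrib)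
    finally show "ereal \<bar>binomial_expectation n p (taylor_estimator f k n) - f p\<bar> \<le> ereal (M / real n ^ k)"
      by simp
  qed
qed

end
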